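(* Let $G$ be an infinite group (written additively), let $H$ be a subgroup of $G$, and let $I(G)$ be the set of elements of $G$ of order $2$. If $U=G\setminus(I(G)\cup H)$ is nonempty, then $|U|=|G|$. *)

theory Defs
  imports "HOL-Algebra.Multiplicative_Group" "HOL-Library.Equipollence"
begin

definition involutions :: "('a, 'b) monoid_scheme \<Rightarrow> 'a set" where
  "involutions G = {x \<in> carrier G. group.ord G x = 2}"

end

(* If U were smaller than G, take K = G when |H| < |G|, and K = H otherwise. In the second case
   the coset uH of some u in U is not contained in U, hence contains an involution v. In both
   cases the identity map, respectively conjugation by v, inverts all but fewer than |K| elements
   of K. An endomorphism that does so inverts every element of K: two elements h, k commute as
   soon as h, k and hk are all inverted, so an inverted k commutes with almost all, hence all, of
   K; therefore the inverted elements form a subgroup with small complement, which must be K.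
   It follows that u has order 2, a contradiction. *)

theory Submission
  imports Defs
begin

text \<open>Bridge to the order on cardinals, where any two sets are comparable and a union of two
  sets smaller than an infinite one stays smaller.\<close>

lemma lepoll_iff_card_of: "A \<lesssim> B \<longleftrightarrow> (card_of A, card_of B) \<in> ordLeq"
  by (simp add: lepoll_def flip: card_of_ordLeq)

lemma not_lepoll_iff_lesspoll: "\<not> A \<lesssim> B \<longleftrightarrow> B \<prec> A"
  using ordLeq_total[OF card_of_Well_order card_of_Well_order, of A B]
  unfolding lepoll_iff_card_of[symmetric] lesspoll_def
  by (meson eqpoll_imp_lepoll eqpoll_sym lepoll_antisym)

lemma lesspoll_iff_card_of: "A \<prec> B \<longleftrightarrow> (card_of A, card_of B) \<in> ordLess"
  using not_ordLeq_iff_ordLess[OF card_of_Well_order card_of_Well_order]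
  by (metis lepoll_iff_card_of not_lepoll_iff_lesspoll)

lemma Un_lesspoll_infinite:
  assumes "infinite C" "A \<prec> C" "B \<prec> C"
  shows "A \<union> B \<prec> C"
  using card_of_Un_ordLess_infinite assms unfolding lesspoll_iff_card_of by blast

context group
begin

text \<open>If \<open>x\<close> lies in \<open>H - C\<close>, the coset \<open>xC\<close> lies in
  \<open>H - C\<close> too, so \<open>C\<close> is no larger than its complement. Then
  \<open>H\<close> would be a union of two sets smaller than itself.\<close>

lemma subgroup_eq_if_small_complement:
  assumes C: "subgroup C G" and H: "subgroup H G" "infinite H"
    and sub: "C \<subseteq> H" and small: "H - C \<prec> H"
  shows "C = H"
proof (rule ccontr)
  assume "C \<noteq> H"
  then obtain x where x: "x \<in> H" "x \<notin> C" using sub by blast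
  have cl: "y \<in> carrier G" if "y \<in> H" for y
    using subgroup.mem_carrier[OF H(1) that] .
  have "x \<otimes> c \<in> H - C" if c: "c \<in> C" for c
  proof -
    have "x = (x \<otimes> c) \<otimes> inv c" using cl x c sub by (auto simp: m_assoc)
    then have "x \<otimes> c \<notin> C"
      using x(2) subgroup.m_closed[OF C _ subgroup.m_inv_closed[OF C c]] by metis
    moreover have "x \<otimes> c \<in> H" using H(1) x(1) c sub by (auto intro: subgroup.m_closed)
    ultimately show ?thesis by blast
  qed
  moreover have "inj_on ((\<otimes>) x) C"
    using inj_on_cmult[OF cl[OF x(1)]] by (rule inj_on_subset) (use cl sub in blast)
  ultimately have "C \<lesssim> H - C" unfolding lepoll_def by blast
  then have "C \<prec> H" using small lesspoll_trans1 by blast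
  then have "C \<union> (H - C) \<prec> H" using Un_lesspoll_infinite H(2) small by blast
  moreover have "C \<union> (H - C) = H" using sub by blast
  ultimately show False by simp
qed

text \<open>The theorem applies this to the identity on \<open>carrier G\<close> and to conjugation
  by an involution on \<open>H\<close>. The inverted elements first turn out to centralise
  \<open>H\<close>; only this makes them closed under products.\<close>

lemma hom_eq_inv_if_almost_all:
  assumes \<phi>: "\<phi> \<in> hom G G" and H: "subgroup H G" "infinite H"
    and small: "{h \<in> H. \<phi> h \<noteq> inv h} \<prec> H" and hH: "h \<in> H"
  shows "\<phi> h = inv h"
proof -
  define K where "K = {h \<in> H. \<phi> h = inv h}"
  have cl: "y \<in> carrier G" if "y \<in> H" for y
    using subgroup.mem_carrier[OF H(1) that] .
  have mcl: "y \<otimes> z \<in> H" if "y \<in> H" "z \<in> H" for y z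
    using subgroup.m_closed[OF H(1) that] .
  have icl: "inv y \<in> H" if "y \<in> H" for y
    using subgroup.m_inv_closed[OF H(1) that] .
  have oneH: "\<one> \<in> H" using subgroup.one_closed[OF H(1)] .
  have KH: "y \<in> H" "\<phi> y = inv y" if "y \<in> K" for y using that by (auto simp: K_def)
  have mult: "\<phi> (y \<otimes> z) = \<phi> y \<otimes> \<phi> z" if "y \<in> H" "z \<in> H" for y z
    using \<phi> cl that by (auto simp: hom_def)
  have "H - K = {h \<in> H. \<phi> h \<noteq> inv h}" by (auto simp: K_def)
  with small have HK: "H - K \<prec> H" by simp
  \<comment> \<open>Compare \<open>inv (y \<otimes> k)\<close> with the product of the images, which
    is the inverse of the product in the other order.\<close>
  have comm: "y \<otimes> k = k \<otimes> y" if y: "y \<in> K" and k: "k \<in> K" and yk: "y \<otimes> k \<in> K" for y k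
  proof -
    have c: "y \<in> carrier G" "k \<in> carrier G" using y k KH cl by auto
    have "inv (y \<otimes> k) = inv y \<otimes> inv k"
      using KH[OF yk] KH[OF y] KH[OF k] mult[of y k] by simp
    also have "\<dots> = inv (k \<otimes> y)" using c by (simp add: inv_mult_group)
    finally show ?thesis by (rule inj_onD[OF inv_inj]) (simp_all add: c)
  qed
  have central: "y \<otimes> k = k \<otimes> y" if k: "k \<in> K" and y: "y \<in> H" for y k
  proof -
    \<comment> \<open>The centraliser of \<open>k\<close> in \<open>H\<close>: a subgroup, so a
      small complement forces it to be all of \<open>H\<close>.\<close>
    define C where "C = {y \<in> H. y \<otimes> k = k \<otimes> y}"
    have kc: "k \<in> carrier G" "k \<in> H" using k KH cl by auto
    have "subgroup C G"
    proof (rule subgroupI)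
      show "C \<subseteq> carrier G" using cl by (auto simp: C_def)
      have "\<one> \<in> C" using oneH kc by (simp add: C_def)
      then show "C \<noteq> {}" by blast
    next
      fix a assume "a \<in> C"
      then have a: "a \<in> H" "a \<in> carrier G" "a \<otimes> k = k \<otimes> a" using cl by (auto simp: C_def)
      have "inv a \<otimes> k = inv a \<otimes> (k \<otimes> a) \<otimes> inv a" using a kc by (simp add: m_assoc)
      also have "\<dots> = inv a \<otimes> (a \<otimes> k) \<otimes> inv a" using a by simp
      also have "\<dots> = k \<otimes> inv a" using a(2) kc by (simp flip: m_assoc)
      finally show "inv a \<in> C" using a icl by (simp add: C_def)
    next
      fix a b assume "a \<in> C" "b \<in> C"
      then have ab: "a \<in> H" "a \<in> carrier G" "a \<otimes> k = k \<otimes> a"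
        "b \<in> H" "b \<in> carrier G" "b \<otimes> k = k \<otimes> b" using cl by (auto simp: C_def)
      have "a \<otimes> b \<otimes> k = a \<otimes> k \<otimes> b" using ab(2,5,6) kc(1) by (simp add: m_assoc)
      also have "\<dots> = k \<otimes> a \<otimes> b" by (simp only: ab(3))
      also have "\<dots> = k \<otimes> (a \<otimes> b)" by (rule m_assoc[OF kc(1) ab(2) ab(5)])
      finally show "a \<otimes> b \<in> C" using ab mcl by (simp add: C_def)
    qed
    moreover have "H - C \<prec> H"
    proof -
      \<comment> \<open>By \<open>comm\<close>, an element of \<open>H\<close> outside
        \<open>C\<close> is outside \<open>K\<close> or in \<open>?P\<close>. Right multiplication
        by \<open>k\<close> injects \<open>?P\<close> into \<open>H - K\<close>, so both sets are
        small.\<close>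
      let ?P = "{y \<in> H. y \<otimes> k \<notin> K}"
      have "inj_on (\<lambda>y. y \<otimes> k) ?P"
        using inj_on_multc[OF kc(1)] by (rule inj_on_subset) (use cl in blast)
      moreover have "(\<lambda>y. y \<otimes> k) ` ?P \<subseteq> H - K" using mcl kc by auto
      ultimately have "?P \<lesssim> H - K" unfolding lepoll_def by blast
      then have "?P \<prec> H" using HK lesspoll_trans1 by blast
      then have "(H - K) \<union> ?P \<prec> H" using Un_lesspoll_infinite H(2) HK by blast
      moreover have "H - C \<subseteq> (H - K) \<union> ?P" using comm k by (auto simp: C_def)
      ultimately show ?thesis using lesspoll_trans1 subset_imp_lepoll by blast
    qed
    moreover have "C \<subseteq> H" by (auto simp: C_def)
    ultimately have "C = H" using subgroup_eq_if_small_complement H by blast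
    then show ?thesis using y by (auto simp: C_def)
  qed
  have "subgroup K G"
  proof (rule subgroupI)
    show "K \<subseteq> carrier G" using cl KH by blast
    \<comment> \<open>If \<open>K\<close> were empty, \<open>H - K = H\<close> would be strictly
      smaller than itself.\<close>
    show "K \<noteq> {}"
      using HK by (metis Diff_empty lesspoll_not_refl)
  next
    fix a assume a: "a \<in> K"
    have "\<phi> (inv a) = inv (\<phi> a)"
      using group_hom.hom_inv[of G G \<phi> a] \<phi> a KH cl
      by (simp add: group_hom_def group_hom_axioms_def is_group)
    then show "inv a \<in> K" using a icl by (simp add: K_def)
  next
    fix a b assume ab: "a \<in> K" "b \<in> K"
    then have "\<phi> (a \<otimes> b) = inv (b \<otimes> a)" using KH cl mult by (simp add: inv_mult_group)
    also have "b \<otimes> a = a \<otimes> b" by (rule central[OF ab(1) KH(1)[OF ab(2)]])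
    finally show "a \<otimes> b \<in> K"
      using mcl[OF KH(1)[OF ab(1)] KH(1)[OF ab(2)]] by (simp add: K_def)
  qed
  moreover have "K \<subseteq> H" using KH by blast
  ultimately have "K = H" using subgroup_eq_if_small_complement H HK by blast
  then show ?thesis using hH KH by blast
qed

lemma ord_eq_2_iff:
  assumes "x \<in> carrier G"
  shows "ord x = 2 \<longleftrightarrow> x \<noteq> \<one> \<and> x \<otimes> x = \<one>"
proof -
  have sq: "x [^] (2::nat) = x \<otimes> x" using assms by (simp add: numeral_2_eq_2)
  show ?thesis
  proof
    assume "ord x = 2"
    then show "x \<noteq> \<one> \<and> x \<otimes> x = \<one>"
      using assms sq pow_ord_eq_1[of x] by auto
  next
    assume r: "x \<noteq> \<one> \<and> x \<otimes> x = \<one>"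
    then have "ord x dvd 2" using assms sq by (simp flip: pow_eq_id)
    then have "ord x \<le> 2" "ord x \<noteq> 0"
      \<comment> \<open>The value 0 stands for infinite order; it is excluded because 0 does not
        divide 2.\<close>
      using dvd_imp_le[of "ord x" 2] by (auto intro!: Nat.gr0I)
    moreover have "ord x \<noteq> 1" using r assms ord_eq_1 by blast
    ultimately show "ord x = 2" by linarith
  qed
qed

end

theorem theorem4p2:
  fixes G :: "('a, 'b) monoid_scheme" and H :: "'a set"
  assumes "group G"
    and "infinite (carrier G)"
    and "subgroup H G"
    and "carrier G - (involutions G \<union> H) \<noteq> {}"
  shows "carrier G - (involutions G \<union> H) \<approx> carrier G"
proof (rule ccontr)
  interpret group G by fact
  define U where "U = carrier G - (involutions G \<union> H)"
  assume "\<not> carrier G - (involutions G \<union> H) \<approx> carrier G"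
  then have small: "U \<prec> carrier G"
    unfolding U_def lesspoll_def by (simp add: subset_imp_lepoll)
  have sq: "x \<otimes>\<^bsub>G\<^esub> x = \<one>\<^bsub>G\<^esub>" if "x \<in> carrier G" "x \<notin> U" "x \<notin> H" for x
    using that ord_eq_2_iff by (auto simp: U_def involutions_def)
  obtain u where u: "u \<in> U" using assms(4) U_def by blast
  then have uG: "u \<in> carrier G" "u \<notin> H" by (auto simp: U_def)
  have unsq: "u \<otimes>\<^bsub>G\<^esub> u \<noteq> \<one>\<^bsub>G\<^esub>"
    using u ord_eq_2_iff subgroup.one_closed[OF assms(3)]
    by (auto simp: U_def involutions_def)
  have cl: "y \<in> carrier G" if "y \<in> H" for y
    using subgroup.mem_carrier[OF assms(3) that] .
  show False
  proof (cases "H \<prec> carrier G")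
    case True
    then have "U \<union> H \<prec> carrier G" using Un_lesspoll_infinite small assms(2) by blast
    \<comment> \<open>An element outside \<open>U\<close> and \<open>H\<close> squares to the
      identity, so it is its own inverse.\<close>
    moreover have "{x \<in> carrier G. id x \<noteq> inv\<^bsub>G\<^esub> x} \<subseteq> U \<union> H"
    proof (clarsimp, rule ccontr)
      fix x assume x: "x \<in> carrier G" "x \<noteq> inv\<^bsub>G\<^esub> x" "x \<notin> H" "x \<notin> U"
      then show False using sq inv_equality[of x x] by simp
    qed
    ultimately have "{x \<in> carrier G. id x \<noteq> inv\<^bsub>G\<^esub> x} \<prec> carrier G"
      using lesspoll_trans1 subset_imp_lepoll by blast
    then have "id u = inv\<^bsub>G\<^esub> u"
      using hom_eq_inv_if_almost_all[of id "carrier G" u] assms(2) uG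
      by (simp add: subgroup_self hom_def)
    then show False using unsq uG by (metis id_apply r_inv)
  next
    case False
    then have "carrier G \<lesssim> H" using not_lepoll_iff_lesspoll by blast
    then have HU: "U \<prec> H" using small lesspoll_trans2 by blast
    have "infinite H"
      using \<open>carrier G \<lesssim> H\<close> assms(2) unfolding infinite_le_lepoll by (rule lepoll_trans[rotated])
    have notH: "u \<otimes>\<^bsub>G\<^esub> h \<notin> H" if "h \<in> H" for h
    proof
      assume "u \<otimes>\<^bsub>G\<^esub> h \<in> H"
      then have "(u \<otimes>\<^bsub>G\<^esub> h) \<otimes>\<^bsub>G\<^esub> inv\<^bsub>G\<^esub> h \<in> H"
        using subgroup.m_closed[OF assms(3)] subgroup.m_inv_closed[OF assms(3) that] by blast
      then show False using uG that cl by (simp add: m_assoc)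
    qed
    have trans_small: "{h \<in> H. x \<otimes>\<^bsub>G\<^esub> h \<in> U} \<prec> H" if "x \<in> carrier G" for x
    proof -
      have "inj_on ((\<otimes>\<^bsub>G\<^esub>) x) {h \<in> H. x \<otimes>\<^bsub>G\<^esub> h \<in> U}"
        using inj_on_cmult[OF that] by (rule inj_on_subset) (use cl in blast)
      then have "{h \<in> H. x \<otimes>\<^bsub>G\<^esub> h \<in> U} \<lesssim> U" unfolding lepoll_def by blast
      then show ?thesis using HU lesspoll_trans1 by blast
    qed
    \<comment> \<open>The coset \<open>uH\<close> is as large as \<open>H\<close>, hence too large
      to fit inside \<open>U\<close>; this supplies \<open>k\<close>.\<close>
    have "{h \<in> H. u \<otimes>\<^bsub>G\<^esub> h \<in> U} \<noteq> H" using trans_small[OF uG(1)] lesspoll_not_refl by metis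
    then obtain k where k: "k \<in> H" "u \<otimes>\<^bsub>G\<^esub> k \<notin> U" by blast
    define v where "v = u \<otimes>\<^bsub>G\<^esub> k"
    have v: "v \<in> carrier G" using v_def uG k cl by simp
    have vv: "v \<otimes>\<^bsub>G\<^esub> v = \<one>\<^bsub>G\<^esub>" using sq notH k v v_def by blast
    then have iv: "inv\<^bsub>G\<^esub> v = v" using v inv_equality by blast
    \<comment> \<open>As \<open>v\<close> is its own inverse, this is conjugation by
      \<open>v\<close>.\<close>
    let ?\<phi> = "\<lambda>x. v \<otimes>\<^bsub>G\<^esub> x \<otimes>\<^bsub>G\<^esub> v"
    have hom: "?\<phi> \<in> hom G G"
    proof (rule homI)
      fix x y assume xy: "x \<in> carrier G" "y \<in> carrier G"
      have "?\<phi> x \<otimes>\<^bsub>G\<^esub> ?\<phi> y = v \<otimes>\<^bsub>G\<^esub> x \<otimes>\<^bsub>G\<^esub> (v \<otimes>\<^bsub>G\<^esub> v) \<otimes>\<^bsub>G\<^esub> y \<otimes>\<^bsub>G\<^esub> v"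
        using xy v by (simp add: m_assoc)
      then show "?\<phi> (x \<otimes>\<^bsub>G\<^esub> y) = ?\<phi> x \<otimes>\<^bsub>G\<^esub> ?\<phi> y"
        unfolding vv using xy v by (simp add: m_assoc)
    qed (use v in simp)
    \<comment> \<open>For \<open>h\<close> in \<open>H\<close>, the product \<open>vh\<close> stays
      in the coset \<open>uH\<close>, off \<open>H\<close>. If it is also outside \<open>U\<close>,
      then \<open>vhvh\<close> is the identity, which says that conjugation by \<open>v\<close>
      inverts \<open>h\<close>.\<close>
    have "{h \<in> H. ?\<phi> h \<noteq> inv\<^bsub>G\<^esub> h} \<subseteq> {h \<in> H. v \<otimes>\<^bsub>G\<^esub> h \<in> U}"
    proof (clarsimp, rule ccontr)
      fix h assume h: "h \<in> H" "?\<phi> h \<noteq> inv\<^bsub>G\<^esub> h" "v \<otimes>\<^bsub>G\<^esub> h \<notin> U"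
      have "v \<otimes>\<^bsub>G\<^esub> h = u \<otimes>\<^bsub>G\<^esub> (k \<otimes>\<^bsub>G\<^esub> h)" using h k cl uG by (simp add: v_def m_assoc)
      then have "v \<otimes>\<^bsub>G\<^esub> h \<notin> H" using notH subgroup.m_closed[OF assms(3) k(1) h(1)] by simp
      then have "(v \<otimes>\<^bsub>G\<^esub> h) \<otimes>\<^bsub>G\<^esub> (v \<otimes>\<^bsub>G\<^esub> h) = \<one>\<^bsub>G\<^esub>" using sq h v cl by simp
      then have "?\<phi> h \<otimes>\<^bsub>G\<^esub> h = \<one>\<^bsub>G\<^esub>" using h v cl by (simp add: m_assoc)
      then have "inv\<^bsub>G\<^esub> h = ?\<phi> h" using h v cl by (intro inv_equality) auto
      then show False using h by simp
    qed
    then have "{h \<in> H. ?\<phi> h \<noteq> inv\<^bsub>G\<^esub> h} \<prec> H"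
      using trans_small[OF v] lesspoll_trans1 subset_imp_lepoll by blast
    \<comment> \<open>The element to test is the inverse of \<open>k\<close>: since \<open>u\<close>
      is \<open>v\<close> times it, the square of \<open>u\<close> is its conjugate times itself,
      hence the identity.\<close>
    moreover have ik: "inv\<^bsub>G\<^esub> k \<in> H" using subgroup.m_inv_closed[OF assms(3) k(1)] .
    ultimately have inv: "?\<phi> (inv\<^bsub>G\<^esub> k) = inv\<^bsub>G\<^esub> (inv\<^bsub>G\<^esub> k)"
      using hom_eq_inv_if_almost_all[OF hom assms(3) \<open>infinite H\<close>] by blast
    have "u = v \<otimes>\<^bsub>G\<^esub> inv\<^bsub>G\<^esub> k" using uG k cl by (simp add: v_def m_assoc)
    then have "u \<otimes>\<^bsub>G\<^esub> u = ?\<phi> (inv\<^bsub>G\<^esub> k) \<otimes>\<^bsub>G\<^esub> inv\<^bsub>G\<^esub> k"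
      using v ik cl by (simp add: m_assoc)
    also have "\<dots> = \<one>\<^bsub>G\<^esub>" unfolding inv using k cl by simp
    finally show False using unsq by blast
  qed
qed

end
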